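(* Let $(H;\langle\cdot,\cdot\rangle)$ be a Hilbert space over the real or complex number field $\mathbb{K}$, let $[a,b]$ be a compact interval in $\mathbb{R}$, and let $\eta:[a,b]\to[0,\infty)$ be a Lebesgue integrable function with $\int_a^b\eta(t)\,dt=1$. Let $g\in L_\eta([a,b];H)$ be such that $\int_a^b\eta(t)\|g(t)\|^2dt=1$, let $f_i\in L_\eta([a,b];H)$ for $i\in\{1,\dots,n\}$, and let $M\ge m>0$ be such that either $$\operatorname{Re}\langle Mf_j(t)-f_i(t),\,f_i(t)-mf_j(t)\rangle\ge0$$ or, equivalently, $$\Big\|f_i(t)-\frac{m+M}{2}f_j(t)\Big\|\le\frac12(M-m)\|f_j(t)\|$$ for a.e. $t\in[a,b]$ and all $1\le i<j\le n$. Then $$\Big[\sum_{i=1}^n\Big(\int_a^b\eta(t)\|f_i(t)\|^2dt\Big)^{1/2}\Big]^2\le\int_a^b\eta(t)\Big\|\sum_{i=1}^n f_i(t)\Big\|^2dt+\frac12\cdot\frac{(M-m)^2}{m+M}\int_a^b\eta(t)\Big(\sum_{k=1}^{n-1}k\|f_{k+1}(t)\|^2\Big)dt.$$ Equality holds in this last inequality if and only if $$\Big(\int_a^b\eta(t)\|f_i(t)\|^2dt\Big)^{1/2}\Big(\int_a^b\eta(t)\|f_j(t)\|^2dt\Big)^{1/2}-\int_a^b\eta(t)\operatorname{Re}\langle f_i(t),f_j(t)\rangle dt=\frac14\cdot\frac{(M-m)^2}{m+M}\int_a^b\eta(t)\|f_j(t)\|^2dt$$ for each $i,j$ with $1\le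 i<j\le n$.
   Context: $n$ is a positive integer and $\|\cdot\|$ is the norm on $H$ induced by its inner product. $L_\eta([a,b];H)$ denotes the Hilbert space of all Bochner measurable functions $f:[a,b]\to H$ with $\int_a^b\eta(t)\|f(t)\|^2dt<\infty$, with inner product $\langle f,g\rangle_\eta:=\int_a^b\eta(t)\langle f(t),g(t)\rangle dt$. *)

theory Defs
  imports "HOL-Analysis.Analysis"
begin

text \<open>A Hilbert space over \<open>K\<close>, where \<open>K\<close> is the real or the complex field. Both fields are
  represented as subsets of the complex numbers, so that conjugation and real part are available
  uniformly; for \<open>K = \<real>\<close> only the values of \<open>scale\<close> at real scalars matter. Topology, norm and
  completeness come from the type class \<open>banach\<close>; the last assumption says that this norm is
  the one induced by the inner product \<open>ip\<close>, which is linear in its first argument.\<close>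

locale hilbert_space_over =
  fixes K :: "complex set"
    and scale :: "complex \<Rightarrow> 'h::banach \<Rightarrow> 'h"
    and ip :: "'h \<Rightarrow> 'h \<Rightarrow> complex"
  assumes scalars: "K = \<real> \<or> K = UNIV"
    and scale_add_right: "c \<in> K \<Longrightarrow> scale c (x + y) = scale c x + scale c y"
    and scale_add_left: "c \<in> K \<Longrightarrow> d \<in> K \<Longrightarrow> scale (c + d) x = scale c x + scale d x"
    and scale_scale: "c \<in> K \<Longrightarrow> d \<in> K \<Longrightarrow> scale c (scale d x) = scale (c * d) x"
    and scale_of_real: "scale (complex_of_real r) x = r *\<^sub>R x"
    and ip_in: "ip x y \<in> K"
    and ip_add_left: "ip (x + y) z = ip x z + ip y z"
    and ip_scale_left: "c \<in> K \<Longrightarrow> ip (scale c x) y = c * ip x y"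
    and ip_commute: "ip y x = cnj (ip x y)"
    and ip_nonneg: "0 \<le> Re (ip x x)"
    and ip_eq_zero_iff: "ip x x = 0 \<longleftrightarrow> x = 0"
    and norm_eq_sqrt_ip: "norm x = sqrt (Re (ip x x))"

text \<open>Every real Hilbert space in the sense of the type classes is an instance, and so is the
  complex line.\<close>

lemma hilbert_space_over_real_inner:
  "hilbert_space_over \<real> (\<lambda>c (x :: 'h::{real_inner, banach}). Re c *\<^sub>R x)
     (\<lambda>x y. complex_of_real (x \<bullet> y))"
  by unfold_locales
    (auto simp: Reals_def inner_add_left inner_add_right inner_commute scaleR_add_right scaleR_add_left
      norm_eq_sqrt_inner)

lemma hilbert_space_over_complex:
  "hilbert_space_over UNIV (\<lambda>c x :: complex. c * x) (\<lambda>x y. x * cnj y)"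
  by unfold_locales
    (auto simp: algebra_simps scaleR_conv_of_real norm_complex_def power2_eq_square)

text \<open>Bochner (strong) measurability: an a.e. limit of simple functions. For a non-separable
  space this is stronger than Borel measurability. Only the values on \<open>{a..b}\<close> matter.\<close>

definition bochner_measurable_on :: "real \<Rightarrow> real \<Rightarrow> (real \<Rightarrow> 'h::banach) \<Rightarrow> bool" where
  "bochner_measurable_on a b f \<longleftrightarrow>
     (\<exists>s. (\<forall>k::nat. simple_function (lebesgue_on {a..b}) (s k)) \<and>
          (AE t in lebesgue_on {a..b}. (\<lambda>k. s k t) \<longlonglongrightarrow> f t))"

definition L_weighted :: "(real \<Rightarrow> real) \<Rightarrow> real \<Rightarrow> real \<Rightarrow> (real \<Rightarrow> 'h::banach) set" where
  "L_weighted \<eta> a b =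
     {f. bochner_measurable_on a b f \<and>
         integrable (lebesgue_on {a..b}) (\<lambda>t. \<eta> t * (norm (f t))\<^sup>2)}"

end

theory Submission
  imports Defs
begin

text \<open>
  The inequality compares two expansions into pairs. Write \<open>G i j\<close> for
  \<open>\<integral> \<eta> Re \<langle>f i, f j\<rangle>\<close>, the real semi-inner product of the weighted \<open>L\<^sup>2\<close> space, and
  \<open>A i = \<surd> (G i i)\<close> for the weighted norms. Then \<open>(\<Sum>i. A i)\<^sup>2\<close> and
  \<open>\<integral> \<eta> \<parallel>\<Sum>i. f i\<parallel>\<^sup>2\<close> have the same diagonal part \<open>\<Sum>i. (A i)\<^sup>2\<close>, so their difference is
  twice the sum over \<open>i < j\<close> of the
  Schwarz deficits \<open>A i * A j - G i j\<close>. If each deficit is at most \<open>c * (A j)\<^sup>2\<close>, then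
  \<open>A j\<close> is charged once for every \<open>i < j\<close>, which yields the weights \<open>j - 1\<close>; and a finite sum of
  valid inequalities is an equality exactly when each summand is
  (\<open>square_sum_le_of_schwarz_deficit\<close>).

  The bound on the deficits (\<open>weighted_schwarz_deficit\<close>) is a reverse Schwarz inequality. Both forms
  of the pointwise hypothesis on \<open>x = f i t\<close> and \<open>y = f j t\<close> expand to
  \<open>\<parallel>x\<parallel>\<^sup>2 + m M \<parallel>y\<parallel>\<^sup>2 \<le> (m + M) Re \<langle>x, y\<rangle>\<close>. This form is linear in the quadratic quantities and so
  survives integration, and the rest is the completed square
  \<open>0 \<le> (A i - (m + M) / 2 * A j)\<^sup>2\<close>.

  The pairwise integrands have to be integrable for this. As \<open>H\<close> may be non-separable, measurability
  comes from Bochner measurability: a continuous real function of two a.e. limits of simple functions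
  is an a.e. limit of real simple functions, and Lebesgue measure is complete.
\<close>

section \<open>Expansion into pairs\<close>

lemma sum_sum_symmetric_split:
  fixes G :: "nat \<Rightarrow> nat \<Rightarrow> real"
  assumes "\<And>i j. G i j = G j i"
  shows "(\<Sum>i=1..n. \<Sum>j=1..n. G i j) = (\<Sum>i=1..n. G i i) + 2 * (\<Sum>j=1..n. \<Sum>i=1..<j. G i j)"
proof (induction n)
  case (Suc n)
  have "(\<Sum>i=1..Suc n. \<Sum>j=1..Suc n. G i j)
      = (\<Sum>i=1..n. \<Sum>j=1..n. G i j) + (\<Sum>i=1..n. G i (Suc n)) + (\<Sum>j=1..n. G (Suc n) j) + G (Suc n) (Suc n)"
    by (simp add: sum.distrib)
  also have "(\<Sum>j=1..n. G (Suc n) j) = (\<Sum>i=1..n. G i (Suc n))"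
    by (intro sum.cong refl assms)
  finally show ?case
    using Suc by (simp add: atLeastLessThanSuc_atLeastAtMost)
qed simp

text \<open>The index \<open>j = k + 1\<close> is the larger one in exactly \<open>k\<close> pairs. This is where the
  lopsided weights of the final inequality come from.\<close>

lemma sum_pairs_weight:
  fixes B :: "nat \<Rightarrow> real"
  shows "(\<Sum>j=1..n. \<Sum>i=1..<j. B j) = (\<Sum>k=1..n-1. real k * B (k + 1))"
proof (induction n)
  case (Suc n)
  then show ?case by (cases n) simp_all
qed simp

text \<open>The double sum of \<open>G\<close> stands for \<open>\<parallel>\<Sum>i. f i\<parallel>\<^sup>2\<close> in a space where \<open>A\<close> gives the norms and
  \<open>G\<close> the inner products. The difference of the two sides is twice the total slack in the
  assumed inequalities, and both claims follow from this identity.\<close>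

lemma square_sum_le_of_schwarz_deficit:
  fixes A :: "nat \<Rightarrow> real" and G :: "nat \<Rightarrow> nat \<Rightarrow> real"
  assumes sym: "\<And>i j. G i j = G j i"
    and diag: "\<And>i. i \<in> {1..n} \<Longrightarrow> G i i = (A i)\<^sup>2"
    and deficit: "\<And>i j. 1 \<le> i \<Longrightarrow> i < j \<Longrightarrow> j \<le> n \<Longrightarrow> A i * A j - G i j \<le> c * (A j)\<^sup>2"
  defines "bound \<equiv> (\<Sum>i=1..n. \<Sum>j=1..n. G i j) + 2 * c * (\<Sum>k=1..n-1. real k * (A (k + 1))\<^sup>2)"
  shows "(\<Sum>i=1..n. A i)\<^sup>2 \<le> bound"
    and "(\<Sum>i=1..n. A i)\<^sup>2 = bound \<longleftrightarrow>
      (\<forall>i j. 1 \<le> i \<and> i < j \<and> j \<le> n \<longrightarrow> A i * A j - G i j = c * (A j)\<^sup>2)"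
proof -
  define slack where "slack i j = c * (A j)\<^sup>2 - (A i * A j - G i j)" for i j
  have slack_nonneg: "0 \<le> slack i j" if "j \<in> {1..n}" "i \<in> {1..<j}" for i j
    using deficit[of i j] that by (simp add: slack_def)
  have "(\<Sum>i=1..n. A i)\<^sup>2 = (\<Sum>i=1..n. \<Sum>j=1..n. A i * A j)"
    by (simp add: power2_eq_square sum_product)
  also have "\<dots> = (\<Sum>i=1..n. A i * A i) + 2 * (\<Sum>j=1..n. \<Sum>i=1..<j. A i * A j)"
    by (rule sum_sum_symmetric_split) (rule mult.commute)
  also have "(\<Sum>i=1..n. A i * A i) = (\<Sum>i=1..n. G i i)"
    by (intro sum.cong refl) (simp add: diag power2_eq_square)
  finally have square: "(\<Sum>i=1..n. A i)\<^sup>2 = (\<Sum>i=1..n. G i i) + 2 * (\<Sum>j=1..n. \<Sum>i=1..<j. A i * A j)" .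
  have weights: "c * (\<Sum>k=1..n-1. real k * (A (k + 1))\<^sup>2) = (\<Sum>j=1..n. \<Sum>i=1..<j. c * (A j)\<^sup>2)"
    unfolding sum_pairs_weight[where B = "\<lambda>j. (A j)\<^sup>2", symmetric] by (simp only: sum_distrib_left)
  have "bound - (\<Sum>i=1..n. A i)\<^sup>2 = 2 * ((\<Sum>j=1..n. \<Sum>i=1..<j. c * (A j)\<^sup>2)
      - ((\<Sum>j=1..n. \<Sum>i=1..<j. A i * A j) - (\<Sum>j=1..n. \<Sum>i=1..<j. G i j)))"
    using sum_sum_symmetric_split[of G n, OF sym] square weights by (simp add: bound_def)
  also have "\<dots> = 2 * (\<Sum>j=1..n. \<Sum>i=1..<j. slack i j)"
    by (simp only: slack_def sum_subtractf)
  finally have gap: "bound - (\<Sum>i=1..n. A i)\<^sup>2 = 2 * (\<Sum>j=1..n. \<Sum>i=1..<j. slack i j)" .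
  have inner_nonneg: "0 \<le> (\<Sum>i=1..<j. slack i j)" if "j \<in> {1..n}" for j
    by (intro sum_nonneg slack_nonneg that)
  have "0 \<le> (\<Sum>j=1..n. \<Sum>i=1..<j. slack i j)"
    by (intro sum_nonneg inner_nonneg)
  then show "(\<Sum>i=1..n. A i)\<^sup>2 \<le> bound"
    using gap by simp
  have "(\<Sum>i=1..n. A i)\<^sup>2 = bound \<longleftrightarrow> (\<Sum>j=1..n. \<Sum>i=1..<j. slack i j) = 0"
    using gap by linarith
  also have "\<dots> \<longleftrightarrow> (\<forall>j\<in>{1..n}. (\<Sum>i=1..<j. slack i j) = 0)"
    by (intro sum_nonneg_eq_0_iff finite_atLeastAtMost inner_nonneg)
  also have "\<dots> \<longleftrightarrow> (\<forall>j\<in>{1..n}. \<forall>i\<in>{1..<j}. slack i j = 0)"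
    by (intro ball_cong refl sum_nonneg_eq_0_iff finite_atLeastLessThan slack_nonneg)
  also have "\<dots> \<longleftrightarrow> (\<forall>i j. 1 \<le> i \<and> i < j \<and> j \<le> n \<longrightarrow> A i * A j - G i j = c * (A j)\<^sup>2)"
    unfolding slack_def by force
  finally show "(\<Sum>i=1..n. A i)\<^sup>2 = bound \<longleftrightarrow>
      (\<forall>i j. 1 \<le> i \<and> i < j \<and> j \<le> n \<longrightarrow> A i * A j - G i j = c * (A j)\<^sup>2)" .
qed

section \<open>The real part of the inner product\<close>

text \<open>Only \<open>Re \<langle>x, y\<rangle>\<close> enters the argument. It is a real inner product with the same norm, for both
  choices of the field of scalars.\<close>

context hilbert_space_over
begin

lemma Re_ip_commute: "Re (ip x y) = Re (ip y x)"
  using ip_commute[of x y] by simp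

lemma Re_ip_scaleR_left: "Re (ip (r *\<^sub>R x) y) = r * Re (ip x y)"
proof -
  have "complex_of_real r \<in> K"
    using scalars by auto
  then have "ip (scale (complex_of_real r) x) y = complex_of_real r * ip x y"
    by (rule ip_scale_left)
  then show ?thesis
    by (simp add: scale_of_real)
qed

lemma Re_ip_scaleR_right: "Re (ip x (r *\<^sub>R y)) = r * Re (ip x y)"
  by (metis Re_ip_commute Re_ip_scaleR_left)

lemma Re_ip_add_right: "Re (ip x (y + z)) = Re (ip x y) + Re (ip x z)"
  by (metis Re_ip_commute ip_add_left plus_complex.sel(1))

lemma Re_ip_diff_left: "Re (ip (x - y) z) = Re (ip x z) - Re (ip y z)"
  using arg_cong[OF ip_add_left[of "x - y" y z], of Re] by simp

lemma Re_ip_diff_right: "Re (ip x (y - z)) = Re (ip x y) - Re (ip x z)"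
  by (metis Re_ip_commute Re_ip_diff_left)

lemma Re_ip_self: "Re (ip x x) = (norm x)\<^sup>2"
  using ip_nonneg[of x] by (simp add: norm_eq_sqrt_ip)

lemma Re_ip_sum_left: "Re (ip (\<Sum>i\<in>I. u i) y) = (\<Sum>i\<in>I. Re (ip (u i) y))"
proof (induction I rule: infinite_finite_induct)
  case empty
  show ?case
    using Re_ip_scaleR_left[of 0 0 y] by simp
next
  case (infinite I)
  then show ?case
    using Re_ip_scaleR_left[of 0 0 y] by simp
qed (simp add: ip_add_left)

lemma norm_sum_square_expand: "(norm (\<Sum>i\<in>I. u i))\<^sup>2 = (\<Sum>i\<in>I. \<Sum>j\<in>I. Re (ip (u i) (u j)))"
proof -
  have "Re (ip (u i) (\<Sum>j\<in>I. u j)) = (\<Sum>j\<in>I. Re (ip (u i) (u j)))" for i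
    unfolding Re_ip_commute[of "u i"] by (rule Re_ip_sum_left)
  then show ?thesis
    by (simp add: Re_ip_self[symmetric] Re_ip_sum_left)
qed

lemmas Re_ip_simps = ip_add_left Re_ip_add_right Re_ip_diff_left Re_ip_diff_right
  Re_ip_scaleR_left Re_ip_scaleR_right

lemma Re_ip_polarization: "Re (ip x y) = ((norm (x + y))\<^sup>2 - (norm (x - y))\<^sup>2) / 4"
  using Re_ip_commute[of x y] by (simp add: Re_ip_self[symmetric] Re_ip_simps)

lemma abs_Re_ip_le: "\<bar>Re (ip x y)\<bar> \<le> ((norm x)\<^sup>2 + (norm y)\<^sup>2) / 2"
proof -
  have "0 \<le> Re (ip (x + y) (x + y))" "0 \<le> Re (ip (x - y) (x - y))"
    by (rule ip_nonneg)+
  then show ?thesis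
    using Re_ip_commute[of x y] by (simp add: Re_ip_self[symmetric] Re_ip_simps)
qed

lemma Re_ip_between_expand:
  "Re (ip (M *\<^sub>R y - x) (x - m *\<^sub>R y)) = (m + M) * Re (ip x y) - (norm x)\<^sup>2 - m * M * (norm y)\<^sup>2"
  using Re_ip_commute[of x y]
  by (simp add: Re_ip_self[symmetric] Re_ip_simps algebra_simps)

lemma norm_diff_scaleR_square:
  "(norm (x - r *\<^sub>R y))\<^sup>2 = (norm x)\<^sup>2 - 2 * r * Re (ip x y) + r\<^sup>2 * (norm y)\<^sup>2"
  unfolding Re_ip_self[symmetric] using Re_ip_commute[of x y]
  by (simp add: Re_ip_simps algebra_simps power2_eq_square)

text \<open>The points \<open>m y\<close> and \<open>M y\<close> are the ends of a diameter of the ball in the second condition,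
  and \<open>x\<close> lies in the ball iff it sees the diameter under an angle of at least a right angle.\<close>

lemma Re_ip_between_iff_norm:
  assumes "m \<le> M"
  shows "0 \<le> Re (ip (M *\<^sub>R y - x) (x - m *\<^sub>R y)) \<longleftrightarrow>
    norm (x - ((m + M) / 2) *\<^sub>R y) \<le> 1 / 2 * (M - m) * norm y"
proof -
  have "(norm (x - ((m + M) / 2) *\<^sub>R y))\<^sup>2
      = (norm x)\<^sup>2 - (m + M) * Re (ip x y) + ((m + M) / 2)\<^sup>2 * (norm y)\<^sup>2"
    unfolding norm_diff_scaleR_square by simp
  moreover have "(1 / 2 * (M - m) * norm y)\<^sup>2 = ((m + M) / 2)\<^sup>2 * (norm y)\<^sup>2 - m * M * (norm y)\<^sup>2"
    by (simp add: power2_eq_square field_simps)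
  ultimately have "Re (ip (M *\<^sub>R y - x) (x - m *\<^sub>R y))
      = (1 / 2 * (M - m) * norm y)\<^sup>2 - (norm (x - ((m + M) / 2) *\<^sub>R y))\<^sup>2"
    by (simp add: Re_ip_between_expand)
  then show ?thesis
    using assms by (simp add: power2_le_iff_abs_le)
qed

end

section \<open>Measurability and integrability\<close>

lemma complete_measure_lebesgue_on:
  assumes "S \<in> sets lebesgue"
  shows "complete_measure (lebesgue_on S)"
proof
  fix A B assume "B \<subseteq> A" "A \<in> null_sets (lebesgue_on S)"
  then have "B \<in> null_sets (lebesgue_on S)"
    using assms completion.complete2 by (auto simp: null_sets_restrict_space)
  then show "B \<in> sets (lebesgue_on S)"
    by auto
qed

lemma (in complete_measure) measurable_cong_AE:
  assumes h: "h \<in> M \<rightarrow>\<^sub>M N" and ae: "AE x in M. h x = h' x"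
    and space: "\<And>x. x \<in> space M \<Longrightarrow> h' x \<in> space N"
  shows "h' \<in> M \<rightarrow>\<^sub>M N"
proof (rule measurableI)
  fix A assume A: "A \<in> sets N"
  show "h' -` A \<inter> space M \<in> sets M"
  proof (rule in_sets_AE)
    show "AE x in M. x \<in> h -` A \<inter> space M \<longleftrightarrow> x \<in> h' -` A \<inter> space M"
      using ae by eventually_elim auto
  qed (use measurable_sets[OF h A] in auto)
qed (fact space)

text \<open>For Borel measurable \<open>u\<close> and \<open>v\<close> the usual argument through the pair \<open>(u, v)\<close> breaks down
  on a non-separable space, where rectangles need not generate the Borel sets of the product.
  Bochner measurability avoids the product space: a function of two simple functions is simple,
  whatever the space, and the limit is taken among real functions.\<close>

lemma bochner_measurable_compose2:
  fixes u v :: "real \<Rightarrow> 'h::banach" and h :: "'h \<Rightarrow> 'h \<Rightarrow> real"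
  assumes "bochner_measurable_on a b u" and "bochner_measurable_on a b v"
    and cont: "\<And>X Y x y. X \<longlonglongrightarrow> x \<Longrightarrow> Y \<longlonglongrightarrow> y \<Longrightarrow> (\<lambda>k. h (X k) (Y k)) \<longlonglongrightarrow> h x y"
  shows "(\<lambda>t. h (u t) (v t)) \<in> borel_measurable (lebesgue_on {a..b})"
proof -
  interpret complete_measure "lebesgue_on {a..b}"
    by (rule complete_measure_lebesgue_on) simp
  obtain s where s: "\<And>k::nat. simple_function (lebesgue_on {a..b}) (s k)"
    and s_lim: "AE t in lebesgue_on {a..b}. (\<lambda>k. s k t) \<longlonglongrightarrow> u t"
    using assms(1) unfolding bochner_measurable_on_def by blast
  obtain r where r: "\<And>k::nat. simple_function (lebesgue_on {a..b}) (r k)"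
    and r_lim: "AE t in lebesgue_on {a..b}. (\<lambda>k. r k t) \<longlonglongrightarrow> v t"
    using assms(2) unfolding bochner_measurable_on_def by blast
  have "(\<lambda>t. lim (\<lambda>k. h (s k t) (r k t))) \<in> borel_measurable (lebesgue_on {a..b})"
    using simple_function_compose2[OF s r, of h]
    by (intro borel_measurable_lim_metric borel_measurable_simple_function)
  moreover have "AE t in lebesgue_on {a..b}. lim (\<lambda>k. h (s k t) (r k t)) = h (u t) (v t)"
    using s_lim r_lim by eventually_elim (intro limI cont)
  ultimately show ?thesis
    by (rule measurable_cong_AE) simp
qed

section \<open>The weighted reverse Schwarz inequality\<close>

context hilbert_space_over
begin

lemma integrable_weighted_Re_ip:
  assumes \<eta>_nonneg: "\<And>t. t \<in> {a..b} \<Longrightarrow> 0 \<le> \<eta> t"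
    and \<eta>_meas: "\<eta> \<in> borel_measurable (lebesgue_on {a..b})"
    and u: "u \<in> L_weighted \<eta> a b" and v: "v \<in> L_weighted \<eta> a b"
  shows "integrable (lebesgue_on {a..b}) (\<lambda>t. \<eta> t * Re (ip (u t) (v t)))"
proof (rule Bochner_Integration.integrable_bound)
  show "integrable (lebesgue_on {a..b}) (\<lambda>t. (\<eta> t * (norm (u t))\<^sup>2 + \<eta> t * (norm (v t))\<^sup>2) / 2)"
    using u v by (simp add: L_weighted_def)
  have "(\<lambda>t. Re (ip (u t) (v t))) \<in> borel_measurable (lebesgue_on {a..b})"
  proof (rule bochner_measurable_compose2[where h = "\<lambda>x y. Re (ip x y)"])
    show "bochner_measurable_on a b u" "bochner_measurable_on a b v"
      using u v by (simp_all add: L_weighted_def)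
    show "(\<lambda>k. Re (ip (X k) (Y k))) \<longlonglongrightarrow> Re (ip x y)" if "X \<longlonglongrightarrow> x" "Y \<longlonglongrightarrow> y" for X Y x y
      unfolding Re_ip_polarization by (intro tendsto_intros that) simp
  qed
  then show "(\<lambda>t. \<eta> t * Re (ip (u t) (v t))) \<in> borel_measurable (lebesgue_on {a..b})"
    using \<eta>_meas by simp
  show "AE t in lebesgue_on {a..b}. norm (\<eta> t * Re (ip (u t) (v t)))
      \<le> norm ((\<eta> t * (norm (u t))\<^sup>2 + \<eta> t * (norm (v t))\<^sup>2) / 2)"
  proof (rule AE_I2)
    fix t assume "t \<in> space (lebesgue_on {a..b})"
    then have "0 \<le> \<eta> t"
      using \<eta>_nonneg by simp
    then have "\<eta> t * \<bar>Re (ip (u t) (v t))\<bar> \<le> \<eta> t * (((norm (u t))\<^sup>2 + (norm (v t))\<^sup>2) / 2)"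
      by (intro mult_left_mono abs_Re_ip_le)
    then show "norm (\<eta> t * Re (ip (u t) (v t))) \<le> norm ((\<eta> t * (norm (u t))\<^sup>2 + \<eta> t * (norm (v t))\<^sup>2) / 2)"
      using \<open>0 \<le> \<eta> t\<close> by (simp add: abs_mult distrib_left)
  qed
qed

text \<open>The hypothesis is first integrated, in the expanded form that bounds \<open>\<langle>u, v\<rangle>\<close> from below
  by \<open>(A\<^sup>2 + m M B\<^sup>2) / (m + M)\<close>, with \<open>A\<close> and \<open>B\<close> the weighted norms. What remains concerns
  two real numbers: the largest value of \<open>A B - (A\<^sup>2 + m M B\<^sup>2) / (m + M)\<close> over \<open>A\<close> is attained at
  \<open>A = (m + M) / 2 * B\<close>.\<close>

lemma weighted_schwarz_deficit:
  assumes \<eta>_nonneg: "\<And>t. t \<in> {a..b} \<Longrightarrow> 0 \<le> \<eta> t"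
    and \<eta>_meas: "\<eta> \<in> borel_measurable (lebesgue_on {a..b})"
    and u: "u \<in> L_weighted \<eta> a b" and v: "v \<in> L_weighted \<eta> a b"
    and pos: "0 < m + M"
    and between: "AE t in lebesgue_on {a..b}. 0 \<le> Re (ip (M *\<^sub>R v t - u t) (u t - m *\<^sub>R v t))"
  shows "sqrt (LINT t|lebesgue_on {a..b}. \<eta> t * (norm (u t))\<^sup>2) *
      sqrt (LINT t|lebesgue_on {a..b}. \<eta> t * (norm (v t))\<^sup>2)
      - (LINT t|lebesgue_on {a..b}. \<eta> t * Re (ip (u t) (v t)))
    \<le> 1 / 4 * ((M - m)\<^sup>2 / (m + M)) * (LINT t|lebesgue_on {a..b}. \<eta> t * (norm (v t))\<^sup>2)"
proof -
  let ?L = "lebesgue_on {a..b}"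
  let ?U = "LINT t|?L. \<eta> t * (norm (u t))\<^sup>2" and ?V = "LINT t|?L. \<eta> t * (norm (v t))\<^sup>2"
    and ?P = "LINT t|?L. \<eta> t * Re (ip (u t) (v t))"
  define A B where "A = sqrt ?U" and "B = sqrt ?V"
  have "0 \<le> ?U" "0 \<le> ?V"
    using \<eta>_nonneg by (auto intro!: Bochner_Integration.integral_nonneg_AE AE_I2)
  then have A: "A\<^sup>2 = ?U" and B: "B\<^sup>2 = ?V"
    by (simp_all add: A_def B_def)
  have [simp]: "integrable ?L (\<lambda>t. \<eta> t * (norm (u t))\<^sup>2)" "integrable ?L (\<lambda>t. \<eta> t * (norm (v t))\<^sup>2)"
    using u v by (simp_all add: L_weighted_def)
  have [simp]: "integrable ?L (\<lambda>t. \<eta> t * Re (ip (u t) (v t)))"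
    by (rule integrable_weighted_Re_ip[OF \<eta>_nonneg \<eta>_meas u v])
  have "(LINT t|?L. \<eta> t * (norm (u t))\<^sup>2 + m * M * (\<eta> t * (norm (v t))\<^sup>2))
      \<le> (LINT t|?L. (m + M) * (\<eta> t * Re (ip (u t) (v t))))"
  proof (rule integral_mono_AE)
    show "AE t in ?L. \<eta> t * (norm (u t))\<^sup>2 + m * M * (\<eta> t * (norm (v t))\<^sup>2)
        \<le> (m + M) * (\<eta> t * Re (ip (u t) (v t)))"
      using between AE_space
    proof eventually_elim
      case (elim t)
      then have "0 \<le> \<eta> t * ((m + M) * Re (ip (u t) (v t)) - (norm (u t))\<^sup>2 - m * M * (norm (v t))\<^sup>2)"
        using \<eta>_nonneg by (simp add: Re_ip_between_expand)
      then show ?case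
        by (simp add: algebra_simps)
    qed
  qed simp_all
  then have "A\<^sup>2 + m * M * B\<^sup>2 \<le> (m + M) * ?P"
    by (simp add: A B)
  \<comment> \<open>This square is \<open>m + M\<close> times the distance to that largest value.\<close>
  moreover have "(A - (m + M) / 2 * B)\<^sup>2 = A\<^sup>2 - (m + M) * (A * B) + (M - m)\<^sup>2 / 4 * B\<^sup>2 + m * M * B\<^sup>2"
    by (simp add: power2_eq_square field_simps)
  moreover have "0 \<le> (A - (m + M) / 2 * B)\<^sup>2"
    by simp
  ultimately have "(m + M) * (A * B - ?P) \<le> (M - m)\<^sup>2 / 4 * B\<^sup>2"
    by (simp add: right_diff_distrib)
  then have "A * B - ?P \<le> (M - m)\<^sup>2 / 4 * B\<^sup>2 / (m + M)"
    unfolding pos_le_divide_eq[OF pos] by (simp only: mult.commute)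
  also have "\<dots> = 1 / 4 * ((M - m)\<^sup>2 / (m + M)) * B\<^sup>2"
    by simp
  finally show ?thesis
    unfolding A_def[symmetric] B_def[symmetric] unfolding B[symmetric] .
qed

end

section \<open>The reverse triangle inequality\<close>

theorem proposition4:
  fixes K :: "complex set"
    and scale :: "complex \<Rightarrow> 'h::banach \<Rightarrow> 'h"
    and ip :: "'h \<Rightarrow> 'h \<Rightarrow> complex"
    and a b m M :: real
    and \<eta> :: "real \<Rightarrow> real"
    and n :: nat
    and g :: "real \<Rightarrow> 'h"
    and f :: "nat \<Rightarrow> real \<Rightarrow> 'h"
  assumes "hilbert_space_over K scale ip"
    and "a \<le> b"
    and "\<And>t. t \<in> {a..b} \<Longrightarrow> 0 \<le> \<eta> t"
    and "integrable (lebesgue_on {a..b}) \<eta>"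
    and "(LINT t|lebesgue_on {a..b}. \<eta> t) = 1"
    and "n \<ge> 1"
    and "g \<in> L_weighted \<eta> a b"
    and "(LINT t|lebesgue_on {a..b}. \<eta> t * (norm (g t))\<^sup>2) = 1"
    and "\<And>i. i \<in> {1..n} \<Longrightarrow> f i \<in> L_weighted \<eta> a b"
    and "0 < m" and "m \<le> M"
  shows
    "let
       cond_ip = (AE t in lebesgue_on {a..b}. \<forall>i j. 1 \<le> i \<and> i < j \<and> j \<le> n \<longrightarrow>
         0 \<le> Re (ip (M *\<^sub>R f j t - f i t) (f i t - m *\<^sub>R f j t)));
       cond_norm = (AE t in lebesgue_on {a..b}. \<forall>i j. 1 \<le> i \<and> i < j \<and> j \<le> n \<longrightarrow>
         norm (f i t - ((m + M) / 2) *\<^sub>R f j t) \<le> 1 / 2 * (M - m) * norm (f j t));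
       lhs = (\<Sum>i=1..n. sqrt (LINT t|lebesgue_on {a..b}. \<eta> t * (norm (f i t))\<^sup>2))\<^sup>2;
       rhs = (LINT t|lebesgue_on {a..b}. \<eta> t * (norm (\<Sum>i=1..n. f i t))\<^sup>2)
         + 1 / 2 * ((M - m)\<^sup>2 / (m + M)) *
           (LINT t|lebesgue_on {a..b}. \<eta> t * (\<Sum>k=1..n-1. real k * (norm (f (k + 1) t))\<^sup>2))
     in
       (cond_ip \<longleftrightarrow> cond_norm) \<and>
       (cond_ip \<or> cond_norm \<longrightarrow>
          lhs \<le> rhs \<and>
          (lhs = rhs \<longleftrightarrow>
             (\<forall>i j. 1 \<le> i \<and> i < j \<and> j \<le> n \<longrightarrow>
                sqrt (LINT t|lebesgue_on {a..b}. \<eta> t * (norm (f i t))\<^sup>2) *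
                sqrt (LINT t|lebesgue_on {a..b}. \<eta> t * (norm (f j t))\<^sup>2)
                - (LINT t|lebesgue_on {a..b}. \<eta> t * Re (ip (f i t) (f j t)))
                = 1 / 4 * ((M - m)\<^sup>2 / (m + M)) *
                  (LINT t|lebesgue_on {a..b}. \<eta> t * (norm (f j t))\<^sup>2))))"
proof -
  interpret hilbert_space_over K scale ip
    by fact
  let ?L = "lebesgue_on {a..b}"
  have \<eta>_meas: "\<eta> \<in> borel_measurable ?L"
    using assms(4) by (rule borel_measurable_integrable)
  define cond_ip where "cond_ip \<longleftrightarrow> (AE t in ?L. \<forall>i j. 1 \<le> i \<and> i < j \<and> j \<le> n \<longrightarrow>
    0 \<le> Re (ip (M *\<^sub>R f j t - f i t) (f i t - m *\<^sub>R f j t)))"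
  define cond_norm where "cond_norm \<longleftrightarrow> (AE t in ?L. \<forall>i j. 1 \<le> i \<and> i < j \<and> j \<le> n \<longrightarrow>
    norm (f i t - ((m + M) / 2) *\<^sub>R f j t) \<le> 1 / 2 * (M - m) * norm (f j t))"
  have cond_iff: "cond_ip \<longleftrightarrow> cond_norm"
    unfolding cond_ip_def cond_norm_def Re_ip_between_iff_norm[OF \<open>m \<le> M\<close>] ..
  define G where "G i j = (LINT t|?L. \<eta> t * Re (ip (f i t) (f j t)))" for i j
  define A where "A i = sqrt (LINT t|?L. \<eta> t * (norm (f i t))\<^sup>2)" for i
  define c where "c = 1 / 4 * ((M - m)\<^sup>2 / (m + M))"
  have integrable: "integrable ?L (\<lambda>t. \<eta> t * Re (ip (f i t) (f j t)))" if "i \<in> {1..n}" "j \<in> {1..n}" for i j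
    using assms(3) \<eta>_meas assms(9)[OF that(1)] assms(9)[OF that(2)] by (rule integrable_weighted_Re_ip)
  have A_square: "(A i)\<^sup>2 = (LINT t|?L. \<eta> t * (norm (f i t))\<^sup>2)" for i
    using assms(3) unfolding A_def
    by (intro real_sqrt_pow2 Bochner_Integration.integral_nonneg_AE AE_I2) simp
  have norm_sum: "(LINT t|?L. \<eta> t * (norm (\<Sum>i=1..n. f i t))\<^sup>2) = (\<Sum>i=1..n. \<Sum>j=1..n. G i j)"
  proof -
    have "(LINT t|?L. \<eta> t * (norm (\<Sum>i=1..n. f i t))\<^sup>2)
        = (LINT t|?L. (\<Sum>i=1..n. \<Sum>j=1..n. \<eta> t * Re (ip (f i t) (f j t))))"
      by (simp only: norm_sum_square_expand sum_distrib_left)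
    also have "\<dots> = (\<Sum>i=1..n. LINT t|?L. (\<Sum>j=1..n. \<eta> t * Re (ip (f i t) (f j t))))"
      by (intro Bochner_Integration.integral_sum Bochner_Integration.integrable_sum integrable)
    also have "\<dots> = (\<Sum>i=1..n. \<Sum>j=1..n. G i j)"
      unfolding G_def by (intro sum.cong refl Bochner_Integration.integral_sum integrable)
    finally show ?thesis .
  qed
  have weighted_sum: "(LINT t|?L. \<eta> t * (\<Sum>k=1..n-1. real k * (norm (f (k + 1) t))\<^sup>2))
      = (\<Sum>k=1..n-1. real k * (A (k + 1))\<^sup>2)"
  proof -
    have "(LINT t|?L. \<eta> t * (\<Sum>k=1..n-1. real k * (norm (f (k + 1) t))\<^sup>2))
        = (LINT t|?L. (\<Sum>k=1..n-1. real k * (\<eta> t * (norm (f (k + 1) t))\<^sup>2)))"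
      by (simp add: sum_distrib_left mult.left_commute)
    also have "\<dots> = (\<Sum>k=1..n-1. LINT t|?L. real k * (\<eta> t * (norm (f (k + 1) t))\<^sup>2))"
    proof (intro Bochner_Integration.integral_sum integrable_mult_right)
      fix k assume "k \<in> {1..n-1}"
      then show "integrable ?L (\<lambda>t. \<eta> t * (norm (f (k + 1) t))\<^sup>2)"
        using assms(9)[of "k + 1"] by (auto simp: L_weighted_def)
    qed
    finally show ?thesis
      by (simp add: A_square)
  qed
  have main: "(\<Sum>i=1..n. A i)\<^sup>2 \<le> (\<Sum>i=1..n. \<Sum>j=1..n. G i j) + 2 * c * (\<Sum>k=1..n-1. real k * (A (k + 1))\<^sup>2)
    \<and> ((\<Sum>i=1..n. A i)\<^sup>2 = (\<Sum>i=1..n. \<Sum>j=1..n. G i j) + 2 * c * (\<Sum>k=1..n-1. real k * (A (k + 1))\<^sup>2)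
      \<longleftrightarrow> (\<forall>i j. 1 \<le> i \<and> i < j \<and> j \<le> n \<longrightarrow> A i * A j - G i j = c * (A j)\<^sup>2))" if cond_ip
  proof -
    have sym: "G i j = G j i" for i j
      unfolding G_def by (simp add: Re_ip_commute[of "f i _"])
    have diag: "G i i = (A i)\<^sup>2" for i
      by (simp add: G_def A_square Re_ip_self)
    have deficit: "A i * A j - G i j \<le> c * (A j)\<^sup>2" if ij: "1 \<le> i" "i < j" "j \<le> n" for i j
      unfolding A_square unfolding A_def G_def c_def
    proof (rule weighted_schwarz_deficit)
      show "AE t in ?L. 0 \<le> Re (ip (M *\<^sub>R f j t - f i t) (f i t - m *\<^sub>R f j t))"
        using \<open>cond_ip\<close> ij unfolding cond_ip_def by (auto elim: eventually_mono)
    qed (use assms ij \<eta>_meas in auto)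
    show ?thesis
      using square_sum_le_of_schwarz_deficit[of G n A c, OF sym diag deficit] by blast
  qed
  have two_c: "1 / 2 * ((M - m)\<^sup>2 / (m + M)) = 2 * c"
  proof -
    have "1 / 2 * x = 2 * (1 / 4 * x)" for x :: real
      by simp
    then show ?thesis
      unfolding c_def .
  qed
  show ?thesis
    unfolding Let_def norm_sum weighted_sum two_c c_def[symmetric]
    unfolding cond_ip_def[symmetric] cond_norm_def[symmetric] G_def[symmetric] A_def[symmetric]
    unfolding A_square[symmetric]
    using main cond_iff by blast
qed

end
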